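(* Let $\{f_n\}_{n\ge1}$ and $\{g_n\}_{n\ge1}$ be sequences of complex numbers and set $g_0=-1$. Then for every $n\ge1$, \[ \sum_{\pi\in\mathcal{C}(n)} f_{|\pi|}\,g_\pi=\sum_{p=1}^{n} f_p\sum_{\substack{k_1+\dots+k_p=n\\ k_i\ge1}} g_{k_1}\cdots g_{k_p}=\sum_{p=1}^{n}\Bigl(\sum_{m=p}^{n} f_m\binom{m}{p}\Bigr)\sum_{\substack{k_1+\dots+k_p=n\\ k_i\ge0}} g_{k_1}\cdots g_{k_p}. \]
   Context: A composition of $n\ge1$ is a sequence $\pi=(n_1,\dots,n_m)$ of integers $n_i\ge1$ with $n_1+\dots+n_m=n$; $\mathcal{C}(n)$ is the set of compositions of $n$, $|\pi|=m$ is the number of parts, and $g_\pi=g_{n_1}\cdots g_{n_m}$. *)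

theory Defs
  imports Complex_Main
begin

definition compositions :: "nat \<Rightarrow> nat list set" where
  "compositions n = {\<pi>. (\<forall>k\<in>set \<pi>. 1 \<le> k) \<and> sum_list \<pi> = n}"

definition list_weight :: "(nat \<Rightarrow> complex) \<Rightarrow> nat list \<Rightarrow> complex" where
  "list_weight g ks = prod_list (map g ks)"

lemma finite_compositions: "finite (compositions n)"
proof (rule finite_subset)
  show "finite {xs. set xs \<subseteq> {..n} \<and> length xs \<le> n}"
    by (rule finite_lists_length_le) simp
  have "length \<pi> \<le> sum_list \<pi>" if "\<forall>k\<in>set \<pi>. 1 \<le> k" for \<pi> :: "nat list"
    using that by (induction \<pi>) auto
  then show "compositions n \<subseteq> {xs. set xs \<subseteq> {..n} \<and> length xs \<le> n}"
    unfolding compositions_def by (auto dest: member_le_sum_list)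
qed

lemma finite_weak_compositions:
  "finite {ks::nat list. length ks = p \<and> sum_list ks = n}"
proof (rule finite_subset)
  show "finite {xs. set xs \<subseteq> {..n} \<and> length xs = p}"
    by (rule finite_lists_length_eq) simp
  show "{ks::nat list. length ks = p \<and> sum_list ks = n} \<subseteq> {xs. set xs \<subseteq> {..n} \<and> length xs = p}"
    by (auto dest: member_le_sum_list)
qed

end

theory Submission
  imports Defs "HOL-Computational_Algebra.Formal_Power_Series"
begin

text \<open>
  Let \<open>G(x) = \<Sum>\<^bsub>k\<ge>1\<^esub> g\<^sub>k x\<^sup>k\<close>. The sum over compositions of \<open>n\<close> with \<open>m\<close> positive parts is the
  coefficient of \<open>x\<^sup>n\<close> in \<open>G\<^sup>m\<close>, and since \<open>g\<^sub>0 = -1\<close> the sum over \<open>p\<close> nonnegative parts is the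
  coefficient of \<open>x\<^sup>n\<close> in \<open>(G - 1)\<^sup>p\<close>. Expanding \<open>G\<^sup>m = ((G - 1) + 1)\<^sup>m\<close> by the binomial theorem and
  exchanging the order of summation gives the identity; the term \<open>p = 0\<close> vanishes because \<open>n \<ge> 1\<close>.
\<close>

unbundle fps_syntax

text \<open>\<open>natpermute n p\<close> is exactly this index set, so
  \<open>fps_power_nth_Suc\<close> gives the claim; that rule covers only positive exponents, hence
  the separate case \<open>p = 0\<close>.\<close>

lemma sum_list_weight_eq_fps_power_nth:
  "(\<Sum>ks | length ks = p \<and> sum_list ks = n. list_weight a ks) = (Abs_fps a ^ p) $ n"
proof (cases p)
  case 0
  have "{ks :: nat list. length ks = 0 \<and> sum_list ks = n} = (if n = 0 then {[]} else {})"
    by auto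
  then show ?thesis
    using 0 by (simp add: list_weight_def)
next
  case (Suc m)
  have "list_weight a ks = (\<Prod>j\<in>{0..m}. Abs_fps a $ (ks ! j))" if "length ks = Suc m" for ks
    using that
    by (simp add: list_weight_def prod.list_conv_set_nth atLeastLessThanSuc_atLeastAtMost
        del: prod.op_ivl_Suc)
  then show ?thesis
    unfolding Suc fps_power_nth_Suc natpermute_def by (intro sum.cong) auto
qed

text \<open>Moves the positivity constraint into the weight: a part 0 now contributes the factor
  0.\<close>

lemma list_weight_remove_zero:
  "list_weight (g(0 := 0)) ks = (if \<forall>k\<in>set ks. 1 \<le> k then list_weight g ks else 0)"
  by (induction ks) (auto simp: list_weight_def)

lemma sum_list_weight_positive_eq_fps_power_nth:
  "(\<Sum>ks | length ks = p \<and> sum_list ks = n \<and> (\<forall>k\<in>set ks. 1 \<le> k). list_weight g ks)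
    = (Abs_fps (g(0 := 0)) ^ p) $ n"
proof -
  have "(Abs_fps (g(0 := 0)) ^ p) $ n
      = (\<Sum>ks | length ks = p \<and> sum_list ks = n. list_weight (g(0 := 0)) ks)"
    by (rule sum_list_weight_eq_fps_power_nth[symmetric])
  also have "\<dots> = (\<Sum>ks | length ks = p \<and> sum_list ks = n \<and> (\<forall>k\<in>set ks. 1 \<le> k). list_weight g ks)"
    by (rule sum.mono_neutral_cong_right)
       (auto simp: finite_weak_compositions list_weight_remove_zero)
  finally show ?thesis ..
qed

text \<open>Parts are at least 1, so the length cannot exceed the sum; the empty list has sum
  0.\<close>

lemma length_composition_bounds:
  assumes "\<pi> \<in> compositions n" "1 \<le> n"
  shows "length \<pi> \<in> {1..n}"
proof -
  have "length ks \<le> sum_list ks" if "\<forall>k\<in>set ks. 1 \<le> k" for ks :: "nat list"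
    using that by (induction ks) auto
  moreover have "\<pi> \<noteq> []"
    using assms by (auto simp: compositions_def)
  ultimately show ?thesis
    using assms by (auto simp: compositions_def Suc_le_eq)
qed

lemma sum_compositions_by_length:
  assumes "1 \<le> n"
  shows "(\<Sum>\<pi>\<in>compositions n. f (length \<pi>) * list_weight g \<pi>)
    = (\<Sum>p=1..n. f p *
        (\<Sum>ks | length ks = p \<and> sum_list ks = n \<and> (\<forall>k\<in>set ks. 1 \<le> k). list_weight g ks))"
proof -
  have "(\<Sum>\<pi>\<in>compositions n. f (length \<pi>) * list_weight g \<pi>)
      = (\<Sum>p=1..n. \<Sum>\<pi> | \<pi> \<in> compositions n \<and> length \<pi> = p. f (length \<pi>) * list_weight g \<pi>)"
    using length_composition_bounds[OF _ assms]
    by (intro sum.group[symmetric]) (auto simp: finite_compositions)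
  also have "\<dots> = (\<Sum>p=1..n. f p *
        (\<Sum>ks | length ks = p \<and> sum_list ks = n \<and> (\<forall>k\<in>set ks. 1 \<le> k). list_weight g ks))"
    unfolding sum_distrib_left by (intro sum.cong) (auto simp: compositions_def)
  finally show ?thesis .
qed

lemma fps_power_remove_constant_nth:
  assumes "g 0 = (-1 :: complex)" "1 \<le> n"
  shows "(Abs_fps (g(0 := 0)) ^ m) $ n = (\<Sum>p=1..m. of_nat (m choose p) * (Abs_fps g ^ p) $ n)"
proof -
  have "Abs_fps (g(0 := 0)) = Abs_fps g + 1"
    using assms(1) by (simp add: fps_eq_iff)
  then have "(Abs_fps (g(0 := 0)) ^ m) $ n = (\<Sum>p\<le>m. of_nat (m choose p) * (Abs_fps g ^ p) $ n)"
    \<comment> \<open>Writing the binomial coefficients as constant series lets them be pulled out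
      of the coefficient of \<open>x^n\<close>.\<close>
    by (simp add: binomial_ring fps_sum_nth fps_of_nat[symmetric])
  also have "\<dots> = (\<Sum>p=1..m. of_nat (m choose p) * (Abs_fps g ^ p) $ n)"
    using assms(2) by (intro sum.mono_neutral_right) (auto simp: not_le)
  finally show ?thesis .
qed

theorem theorem12:
  fixes f g :: "nat \<Rightarrow> complex" and n :: nat
  assumes "g 0 = -1" and "1 \<le> n"
  shows "(\<Sum>\<pi>\<in>compositions n. f (length \<pi>) * list_weight g \<pi>)
       = (\<Sum>p=1..n. f p *
            (\<Sum>ks | length ks = p \<and> sum_list ks = n \<and> (\<forall>k\<in>set ks. 1 \<le> k). list_weight g ks))
       \<and> (\<Sum>p=1..n. f p *
            (\<Sum>ks | length ks = p \<and> sum_list ks = n \<and> (\<forall>k\<in>set ks. 1 \<le> k). list_weight g ks))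
       = (\<Sum>p=1..n. (\<Sum>m=p..n. f m * of_nat (m choose p)) *
            (\<Sum>ks | length ks = p \<and> sum_list ks = n. list_weight g ks))"
proof (intro conjI sum_compositions_by_length)
  show "1 \<le> n" by fact
  let ?W = "\<lambda>p. (Abs_fps g ^ p) $ n"
  have "(\<Sum>m=1..n. f m * (Abs_fps (g(0 := 0)) ^ m) $ n)
      = (\<Sum>m=1..n. \<Sum>p=1..m. f m * of_nat (m choose p) * ?W p)"
    by (simp add: fps_power_remove_constant_nth[of g, OF assms] sum_distrib_left mult.assoc)
  \<comment> \<open>Both sides run over the triangle \<open>1 \<le> p \<le> m \<le> n\<close>, with
    the pair coordinates swapped.\<close>
  also have "\<dots> = (\<Sum>p=1..n. \<Sum>m=p..n. f m * of_nat (m choose p) * ?W p)"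
    unfolding sum.Sigma[OF finite_atLeastAtMost ballI[OF finite_atLeastAtMost]]
    by (rule sum.reindex_bij_witness[where i = prod.swap and j = prod.swap]) auto
  also have "\<dots> = (\<Sum>p=1..n. (\<Sum>m=p..n. f m * of_nat (m choose p)) * ?W p)"
    by (simp add: sum_distrib_right)
  finally show "(\<Sum>p=1..n. f p *
            (\<Sum>ks | length ks = p \<and> sum_list ks = n \<and> (\<forall>k\<in>set ks. 1 \<le> k). list_weight g ks))
       = (\<Sum>p=1..n. (\<Sum>m=p..n. f m * of_nat (m choose p)) *
            (\<Sum>ks | length ks = p \<and> sum_list ks = n. list_weight g ks))"
    \<comment> \<open>Both inner list sums turn into coefficients of powers, the form reached
      above.\<close>
    unfolding sum_list_weight_eq_fps_power_nth sum_list_weight_positive_eq_fps_power_nth .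
qed

end
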